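(* Let $n\ge 1$ and let $A,B,C,D$ be normal $n\times n$ complex matrices. Then for every symmetric norm $\|\cdot\|$, $$\left\|\begin{pmatrix} A & B\\ C & D\end{pmatrix}\right\|\le \big\|\,|A|+|B|+|C|+|D|\,\big\|.$$
   Context: A symmetric (or unitarily invariant) norm is a norm on square complex matrices with $\|X\|=\|UXV\|$ for all matrices $X$ and all unitaries $U,V$. Here $\|\cdot\|$ is a symmetric norm on the $2n\times 2n$ complex matrices, and the norm of an $n\times n$ matrix $Y$ is understood as the norm of the $2n\times 2n$ matrix $\begin{pmatrix} Y&0\\0&0\end{pmatrix}$. For a matrix $Y$, $|Y|=(Y^*Y)^{1/2}$. *)

theory Defs
  imports "Jordan_Normal_Form.Schur_Decomposition"
begin

definition normal_mat :: "complex mat \<Rightarrow> bool" where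
  "normal_mat A \<longleftrightarrow> square_mat A \<and> mat_adjoint A * A = A * mat_adjoint A"

definition unitary_mat :: "nat \<Rightarrow> complex mat \<Rightarrow> bool" where
  "unitary_mat n U \<longleftrightarrow> U \<in> carrier_mat n n \<and>
     mat_adjoint U * U = 1\<^sub>m n \<and> U * mat_adjoint U = 1\<^sub>m n"

(* The quadratic form of a Hermitian matrix is real, so Re loses no information. *)
definition psd_mat :: "nat \<Rightarrow> complex mat \<Rightarrow> bool" where
  "psd_mat n P \<longleftrightarrow> P \<in> carrier_mat n n \<and> mat_adjoint P = P \<and>
     (\<forall>v \<in> carrier_vec n. 0 \<le> Re ((P *\<^sub>v v) \<bullet>c v))"

(* The square root of a positive semidefinite matrix is its unique positive
   semidefinite square root; the value is unspecified for other arguments. *)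
definition psd_sqrt :: "complex mat \<Rightarrow> complex mat" where
  "psd_sqrt M = (THE P. psd_mat (dim_row M) P \<and> P * P = M)"

definition mat_abs :: "complex mat \<Rightarrow> complex mat" where
  "mat_abs Y = psd_sqrt (mat_adjoint Y * Y)"

(* A norm on the m x m matrices; nothing is required of N outside that carrier. *)
definition symmetric_norm :: "nat \<Rightarrow> (complex mat \<Rightarrow> real) \<Rightarrow> bool" where
  "symmetric_norm m N \<longleftrightarrow>
     (\<forall>X \<in> carrier_mat m m. 0 \<le> N X) \<and>
     (\<forall>X \<in> carrier_mat m m. N X = 0 \<longleftrightarrow> X = 0\<^sub>m m m) \<and>
     (\<forall>X \<in> carrier_mat m m. \<forall>c. N (c \<cdot>\<^sub>m X) = cmod c * N X) \<and>
     (\<forall>X \<in> carrier_mat m m. \<forall>Y \<in> carrier_mat m m. N (X + Y) \<le> N X + N Y) \<and>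
     (\<forall>X \<in> carrier_mat m m. \<forall>U V. unitary_mat m U \<and> unitary_mat m V \<longrightarrow>
        N (U * X * V) = N X)"

(* For a norm N on 2n x 2n matrices: the norm of an n x n matrix Y. *)
definition corner_norm :: "nat \<Rightarrow> (complex mat \<Rightarrow> real) \<Rightarrow> complex mat \<Rightarrow> real" where
  "corner_norm n N Y = N (four_block_mat Y (0\<^sub>m n n) (0\<^sub>m n n) (0\<^sub>m n n))"

end

theory Submission
  imports Defs
begin

text \<open>
  A normal matrix \<open>A = W \<Lambda> W\<^sup>*\<close> splits symmetrically: with \<open>X = \<bar>\<Lambda>\<bar>\<^sup>1\<^sup>/\<^sup>2 W\<^sup>*\<close> and
  \<open>Y = sgn(\<Lambda>) \<bar>\<Lambda>\<bar>\<^sup>1\<^sup>/\<^sup>2 W\<^sup>*\<close> one has \<open>A = X\<^sup>* Y\<close> while both \<open>X\<^sup>* X\<close> and \<open>Y\<^sup>* Y\<close> equal \<open>\<bar>A\<bar>\<close>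
  (\<open>normal_factorization\<close>). For a general matrix one of the two Gram matrices would be
  \<open>\<bar>A\<^sup>*\<bar>\<close>; this is where normality enters.

  Splitting the diagonal blocks \<open>A, D\<close> and the off-diagonal blocks \<open>B, C\<close> in this way writes the
  block matrix as \<open>T = X\<^sub>1\<^sup>* Y\<^sub>1 + X\<^sub>2\<^sup>* Y\<^sub>2\<close> with
  \<open>X\<^sub>1\<^sup>* X\<^sub>1 + X\<^sub>2\<^sup>* X\<^sub>2 = (\<bar>A\<bar> + \<bar>B\<bar>) \<oplus> (\<bar>D\<bar> + \<bar>C\<bar>)\<close> and
  \<open>Y\<^sub>1\<^sup>* Y\<^sub>1 + Y\<^sub>2\<^sup>* Y\<^sub>2 = (\<bar>A\<bar> + \<bar>C\<bar>) \<oplus> (\<bar>D\<bar> + \<bar>B\<bar>)\<close>. An arithmetic mean inequality for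
  symmetric norms (\<open>symmetric_norm_arith_mean\<close>) bounds the norm of \<open>T\<close> by half the sum of the norms
  of these two block diagonal matrices. For positive semidefinite \<open>P\<close> and \<open>Q\<close> the norm of \<open>P \<oplus> Q\<close> is
  at most that of \<open>(P + Q) \<oplus> 0\<close> (\<open>symmetric_norm_block_diag_le\<close>), and in both cases \<open>P + Q\<close> is
  \<open>\<bar>A\<bar> + \<bar>B\<bar> + \<bar>C\<bar> + \<bar>D\<bar>\<close>.

  Both norm inequalities rest on one principle: a mean of two unitary transforms of a matrix has at most the norm of
  that matrix. Pinching and monotonicity on diagonal matrices are instances of it. The linear
  algebra needed is the spectral theorem for normal matrices, and the singular value decomposition,
  which is deduced from the spectral theorem.
\<close>

section \<open>Adjoints and unitaries\<close>

lemma adjoint_carrier [simp]: "A \<in> carrier_mat n m \<Longrightarrow> mat_adjoint A \<in> carrier_mat m n"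
  by (auto simp: mat_adjoint_def)

lemma adjoint_dim [simp]:
  "dim_row (mat_adjoint A) = dim_col A" "dim_col (mat_adjoint A) = dim_row A"
  by (auto simp: mat_adjoint_def)

lemma adjoint_entry [simp]:
  fixes A :: "complex mat"
  assumes "i < dim_col A" "j < dim_row A"
  shows "mat_adjoint A $$ (i,j) = cnj (A $$ (j,i))"
  using assms by (simp add: mat_adjoint_def mat_of_rows_index conjugate_complex_def)

lemma cmod_square_eq: "(complex_of_real (cmod z))\<^sup>2 = z * cnj z"
  using complex_norm_square[of z] by simp

lemma mult_entry:
  assumes "A \<in> carrier_mat n m" "B \<in> carrier_mat m l" "i < n" "j < l"
  shows "(A * B) $$ (i,j) = (\<Sum>k<m. A $$ (i,k) * B $$ (k,j))"
  using assms by (auto simp: scalar_prod_def atLeast0LessThan intro!: sum.cong)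

lemma adjoint_adjoint [simp]: "mat_adjoint (mat_adjoint A) = (A :: complex mat)"
  by (rule eq_matI) auto

lemma adjoint_mult:
  assumes "(A :: complex mat) \<in> carrier_mat n m" "B \<in> carrier_mat m l"
  shows "mat_adjoint (A * B) = mat_adjoint B * mat_adjoint A"
proof (rule eq_matI)
  fix i j assume "i < dim_row (mat_adjoint B * mat_adjoint A)"
    "j < dim_col (mat_adjoint B * mat_adjoint A)"
  then have ij: "i < l" "j < n" using assms by auto
  have "mat_adjoint (A * B) $$ (i,j) = cnj ((A * B) $$ (j,i))"
    using ij assms by (intro adjoint_entry) auto
  also have "\<dots> = (\<Sum>k<m. mat_adjoint B $$ (i,k) * mat_adjoint A $$ (k,j))"
    unfolding mult_entry[OF assms ij(2,1)] using ij assms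
    by (auto simp: mult.commute intro!: sum.cong)
  also have "\<dots> = (mat_adjoint B * mat_adjoint A) $$ (i,j)"
    using ij assms by (subst mult_entry[of _ l m _ n]) auto
  finally show "mat_adjoint (A * B) $$ (i,j) = (mat_adjoint B * mat_adjoint A) $$ (i,j)" .
qed (use assms in auto)

lemma adjoint_add:
  assumes "(A :: complex mat) \<in> carrier_mat n m" "B \<in> carrier_mat n m"
  shows "mat_adjoint (A + B) = mat_adjoint A + mat_adjoint B"
  by (rule eq_matI) (use assms in auto)

lemma adjoint_one [simp]: "mat_adjoint (1\<^sub>m n :: complex mat) = 1\<^sub>m n"
  by (rule eq_matI) auto

lemma adjoint_mat_diag [simp]:
  "mat_adjoint (mat_diag n f :: complex mat) = mat_diag n (\<lambda>i. cnj (f i))"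
  by (rule eq_matI) (auto simp: mat_diag_def)

lemma adjoint_four_block_mat:
  assumes "(A :: complex mat) \<in> carrier_mat n m" "B \<in> carrier_mat n m'"
    "C \<in> carrier_mat n' m" "D \<in> carrier_mat n' m'"
  shows "mat_adjoint (four_block_mat A B C D)
    = four_block_mat (mat_adjoint A) (mat_adjoint C) (mat_adjoint B) (mat_adjoint D)"
  by (rule eq_matI) (use assms in \<open>auto simp: adjoint_entry\<close>)

lemma adjoint_zero [simp]: "mat_adjoint (0\<^sub>m n m :: complex mat) = 0\<^sub>m m n"
  by (rule eq_matI) auto

lemma adjoint_block_diag:
  assumes "(A :: complex mat) \<in> carrier_mat n n" "D \<in> carrier_mat m m"
  shows "mat_adjoint (four_block_mat A (0\<^sub>m n m) (0\<^sub>m m n) D)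
    = four_block_mat (mat_adjoint A) (0\<^sub>m n m) (0\<^sub>m m n) (mat_adjoint D)"
  using assms by (simp add: adjoint_four_block_mat[of _ n n _ m _ m])

lemma mult_block_diag:
  assumes "(A :: complex mat) \<in> carrier_mat n n" "D \<in> carrier_mat m m"
    "A' \<in> carrier_mat n n" "D' \<in> carrier_mat m m"
  shows "four_block_mat A (0\<^sub>m n m) (0\<^sub>m m n) D * four_block_mat A' (0\<^sub>m n m) (0\<^sub>m m n) D'
    = four_block_mat (A * A') (0\<^sub>m n m) (0\<^sub>m m n) (D * D')"
  using assms by (simp add: mult_four_block_mat[of _ n n _ m _ m _ _ n _ m])

lemma unitary_carrier: "unitary_mat n U \<Longrightarrow> U \<in> carrier_mat n n"
  by (simp add: unitary_mat_def)

lemma unitary_matI: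
  assumes "U \<in> carrier_mat n n" "mat_adjoint U * U = 1\<^sub>m n"
  shows "unitary_mat n U"
  using assms mat_mult_left_right_inverse[of "mat_adjoint U" n U] by (simp add: unitary_mat_def)

lemma unitary_adjoint: "unitary_mat n U \<Longrightarrow> unitary_mat n (mat_adjoint U)"
  by (simp add: unitary_mat_def)

text \<open>The following instances for square matrices mention a single dimension, so that the simplifier can
  discharge their side conditions once that dimension is fixed.\<close>

lemma mult_assoc_square:
  assumes "(A :: complex mat) \<in> carrier_mat n n" "B \<in> carrier_mat n n" "C \<in> carrier_mat n n"
  shows "A * B * C = A * (B * C)"
  using assms by (rule assoc_mult_mat)

lemma mult_carrier_square [simp]:
  "(A :: complex mat) \<in> carrier_mat n n \<Longrightarrow> B \<in> carrier_mat n n \<Longrightarrow> A * B \<in> carrier_mat n n"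
  by (rule mult_carrier_mat)

lemma adjoint_mult_square:
  assumes "(A :: complex mat) \<in> carrier_mat n n" "B \<in> carrier_mat n n"
  shows "mat_adjoint (A * B) = mat_adjoint B * mat_adjoint A"
  using assms by (rule adjoint_mult)

lemma unitary_cancel:
  assumes "unitary_mat n U" "X \<in> carrier_mat n n"
  shows "mat_adjoint U * (U * X) = X" "U * (mat_adjoint U * X) = X"
  using assms by (auto simp: unitary_mat_def simp flip: mult_assoc_square[of _ n])

lemma unitary_mult:
  assumes "unitary_mat n U" "unitary_mat n V"
  shows "unitary_mat n (U * V)"
proof (rule unitary_matI)
  have c: "U \<in> carrier_mat n n" "V \<in> carrier_mat n n" using assms by (auto simp: unitary_carrier)
  show "U * V \<in> carrier_mat n n" using c by simp
  show "mat_adjoint (U * V) * (U * V) = 1\<^sub>m n"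
    using c assms
    by (simp add: adjoint_mult_square[of _ n] mult_assoc_square[of _ n] unitary_cancel[of n])
       (simp add: unitary_mat_def)
qed

lemma unitary_one: "unitary_mat n (1\<^sub>m n)"
  by (simp add: unitary_mat_def)

lemma unitary_mat_diag:
  assumes "\<And>i. i < n \<Longrightarrow> cmod (f i) = 1"
  shows "unitary_mat n (mat_diag n f)"
proof (rule unitary_matI)
  have "cnj (f i) * f i = 1" if "i < n" for i
    using assms[OF that] cmod_square_eq[of "f i"] by (simp add: mult.commute)
  then have "mat_diag n (\<lambda>i. cnj (f i) * f i) = 1\<^sub>m n"
    by (intro eq_matI) (auto simp: mat_diag_def)
  then show "mat_adjoint (mat_diag n f) * mat_diag n f = 1\<^sub>m n" by simp
qed simp

lemma normal_unitary_conjugate: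
  assumes U: "unitary_mat n U" and A: "A \<in> carrier_mat n n" and nA: "normal_mat A"
  shows "normal_mat (mat_adjoint U * A * U)"
proof -
  have c: "U \<in> carrier_mat n n" using U by (rule unitary_carrier)
  have "mat_adjoint A * (A * U) = A * (mat_adjoint A * U)"
    using nA A c by (simp add: normal_mat_def flip: mult_assoc_square[of _ n])
  then show ?thesis
    using c A U
    by (simp add: normal_mat_def adjoint_mult_square[of _ n] mult_assoc_square[of _ n] unitary_cancel[of n])
qed

lemma cscalar_prod_sum:
  fixes v w :: "complex vec"
  assumes "v \<in> carrier_vec n" "w \<in> carrier_vec n"
  shows "v \<bullet>c w = (\<Sum>k<n. v $ k * cnj (w $ k))"
  using assms by (auto simp: scalar_prod_def atLeast0LessThan conjugate_complex_def intro!: sum.cong)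

text \<open>Completing \<open>v\<close> to a basis, orthogonalising and normalising the columns keeps the first one
  proportional to \<open>v\<close>. This starts the induction in the spectral theorem.\<close>

lemma unitary_first_column:
  fixes v :: "complex vec"
  assumes v: "v \<in> carrier_vec n" and v0: "v \<noteq> 0\<^sub>v n"
  shows "\<exists>W c. unitary_mat n W \<and> col W 0 = c \<cdot>\<^sub>v v"
proof -
  interpret cof_vec_space n "TYPE(complex)" .
  define b where "b = basis_completion v"
  define ws where "ws = gram_schmidt n b"
  from basis_completion[OF v v0, folded b_def]
  have dist_b: "distinct b" and indep: "\<not> lin_dep (set b)" and b: "set b \<subseteq> carrier_vec n"
    and hdb: "hd b = v" and len_b: "length b = n" by auto
  have n: "n > 0" using v v0 by (metis eq_vecI carrier_vecD index_zero_vec(2) not_gr_zero less_nat_zero_code)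
  then obtain vs where bv: "b = v # vs" using hdb len_b by (cases b) auto
  from gram_schmidt_result[OF b dist_b indep refl, folded ws_def]
  have ws: "set ws \<subseteq> carrier_vec n" "corthogonal ws" "length ws = n" by (auto simp: len_b)
  have hdws: "hd ws = v" using gram_schmidt_hd[OF v, of vs, folded bv] ws_def by simp
  have w0: "ws ! 0 = v" using hdws ws(3) n by (metis hd_conv_nth length_greater_0_conv)
  have wc: "ws ! i \<in> carrier_vec n" if "i < n" for i using ws that by auto
  define r where "r = (\<lambda>j. sqrt (\<Sum>k<n. (cmod (ws ! j $ k))\<^sup>2))"
  have ip: "(\<Sum>k<n. ws ! j $ k * cnj (ws ! i $ k))
      = (if i = j then complex_of_real ((r j)\<^sup>2) else 0)" if "i < n" "j < n" for i j
  proof (cases "i = j")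
    case True
    then show ?thesis
      by (simp add: r_def sum_nonneg cmod_square_eq)
  next
    case False
    then have "ws ! j \<bullet>c ws ! i = 0" using corthogonalD[OF ws(2)] that ws(3) by auto
    then show ?thesis using False cscalar_prod_sum[OF wc wc] that by simp
  qed
  have r0: "r j \<noteq> 0" if "j < n" for j
  proof
    assume "r j = 0"
    then have "ws ! j \<bullet>c ws ! j = 0" using ip[OF that that] cscalar_prod_sum[OF wc wc] that by simp
    then show False using corthogonalD[OF ws(2)] that ws(3) by auto
  qed
  define W where "W = mat n n (\<lambda>(i,j). ws ! j $ i / complex_of_real (r j))"
  have Wc: "W \<in> carrier_mat n n" by (simp add: W_def)
  have "mat_adjoint W * W = 1\<^sub>m n"
  proof (rule eq_matI)
    fix i j assume "i < dim_row (1\<^sub>m n :: complex mat)" "j < dim_col (1\<^sub>m n :: complex mat)"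
    then have ij: "i < n" "j < n" by auto
    have "(mat_adjoint W * W) $$ (i,j) = (\<Sum>k<n. cnj (W $$ (k,i)) * W $$ (k,j))"
      using ij Wc by (subst mult_entry[of _ n n _ n]) auto
    also have "\<dots> = (\<Sum>k<n. ws ! j $ k * cnj (ws ! i $ k)) / (complex_of_real (r i) * complex_of_real (r j))"
      using ij unfolding sum_divide_distrib by (intro sum.cong) (auto simp: W_def mult.commute)
    also have "\<dots> = 1\<^sub>m n $$ (i,j)"
      unfolding ip[OF ij] using ij r0[of j] by (auto simp: power2_eq_square)
    finally show "(mat_adjoint W * W) $$ (i,j) = 1\<^sub>m n $$ (i,j)" .
  qed (use Wc in auto)
  then have "unitary_mat n W" using Wc by (intro unitary_matI)
  moreover have "col W 0 = (1 / complex_of_real (r 0)) \<cdot>\<^sub>v v"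
    using n v by (intro eq_vecI) (auto simp: W_def w0)
  ultimately show ?thesis by blast
qed

section \<open>The spectral theorem for normal matrices\<close>

text \<open>Normality equates the squared length of the first column with that of the first row. Both contain
  the corner entry, so if the column has nothing else, neither has the row.\<close>

lemma normal_column_forces_row:
  assumes A: "A \<in> carrier_mat n n" and nA: "normal_mat A"
    and col0: "\<And>i. 0 < i \<Longrightarrow> i < n \<Longrightarrow> A $$ (i,0) = 0"
    and j: "0 < j" "j < n"
  shows "A $$ (0,j) = 0"
proof -
  have n: "0 < n" using j by simp
  have "(\<Sum>k<n. cnj (A $$ (k,0)) * A $$ (k,0)) = (mat_adjoint A * A) $$ (0,0)"
    using A n by (subst mult_entry[of _ n n _ n]) auto
  also have "\<dots> = (A * mat_adjoint A) $$ (0,0)" using nA by (simp add: normal_mat_def)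
  also have "\<dots> = (\<Sum>k<n. A $$ (0,k) * cnj (A $$ (0,k)))"
    using A n by (subst mult_entry[of _ n n _ n]) auto
  finally have "complex_of_real (\<Sum>k<n. (cmod (A $$ (k,0)))\<^sup>2)
      = complex_of_real (\<Sum>k<n. (cmod (A $$ (0,k)))\<^sup>2)"
    by (simp add: cmod_square_eq mult.commute)
  then have eq: "(\<Sum>k<n. (cmod (A $$ (k,0)))\<^sup>2) = (\<Sum>k<n. (cmod (A $$ (0,k)))\<^sup>2)"
    by (simp only: of_real_eq_iff)
  have "(\<Sum>k<n. (cmod (A $$ (k,0)))\<^sup>2) = (cmod (A $$ (0,0)))\<^sup>2 + (\<Sum>k\<in>{..<n}-{0}. (cmod (A $$ (k,0)))\<^sup>2)"
    using n by (intro sum.remove) auto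
  also have "(\<Sum>k\<in>{..<n}-{0}. (cmod (A $$ (k,0)))\<^sup>2) = 0"
    by (intro sum.neutral) (auto simp: col0)
  finally have 1: "(\<Sum>k<n. (cmod (A $$ (k,0)))\<^sup>2) = (cmod (A $$ (0,0)))\<^sup>2" by simp
  have "(\<Sum>k<n. (cmod (A $$ (0,k)))\<^sup>2) = (cmod (A $$ (0,0)))\<^sup>2 + (\<Sum>k\<in>{..<n}-{0}. (cmod (A $$ (0,k)))\<^sup>2)"
    using n by (intro sum.remove) auto
  with eq 1 have "(\<Sum>k\<in>{..<n}-{0}. (cmod (A $$ (0,k)))\<^sup>2) = 0" by simp
  then have "\<forall>k\<in>{..<n}-{0}. (cmod (A $$ (0,k)))\<^sup>2 = 0"
    by (subst (asm) sum_nonneg_eq_0_iff) auto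
  then show ?thesis using j by auto
qed

lemma four_block_lower_right_eq:
  assumes "A1 \<in> carrier_mat n1 m1" "A2 \<in> carrier_mat n1 m2" "A3 \<in> carrier_mat n2 m1" "A4 \<in> carrier_mat n2 m2"
    and "B1 \<in> carrier_mat n1 m1" "B2 \<in> carrier_mat n1 m2" "B3 \<in> carrier_mat n2 m1" "B4 \<in> carrier_mat n2 m2"
    and eq: "four_block_mat A1 A2 A3 A4 = four_block_mat B1 B2 B3 B4"
  shows "A4 = B4"
proof (rule eq_matI)
  fix i j assume "i < dim_row B4" "j < dim_col B4"
  then show "A4 $$ (i,j) = B4 $$ (i,j)"
    using arg_cong[OF eq, of "\<lambda>M. M $$ (n1 + i, m1 + j)"] assms(1-8) by simp
qed (use assms in auto)

text \<open>Deflation: in an orthonormal basis that starts with an eigenvector, the first column of a normal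
  matrix is zero below the corner, hence so is the first row beyond it, and the remaining block is
  again normal. The eigenvalue list is prescribed, in any order, so that two matrices with equal
  characteristic polynomials can be diagonalised to the same diagonal matrix.\<close>

theorem normal_spectral:
  assumes "A \<in> carrier_mat n n" "normal_mat A"
    and "char_poly A = (\<Prod>e\<leftarrow>es. [:- e, 1:])"
  shows "\<exists>U. unitary_mat n U \<and> A = U * mat_diag n ((!) es) * mat_adjoint U"
  using assms
proof (induction es arbitrary: n A)
  case Nil
  then have "n = 0" using degree_monic_char_poly[of A n] by auto
  with Nil show ?case
    by (intro exI[of _ "1\<^sub>m n"] conjI unitary_one eq_matI) auto
next
  case (Cons e es n A)
  note A = Cons.prems(1)
  have cp: "char_poly A = [:-e,1:] * (\<Prod>e\<leftarrow>es. [:- e, 1:])" using Cons.prems(3) by simp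
  have mon: "monic (\<Prod>e\<leftarrow>es. [:- e, 1:])" by (rule monic_prod_list, auto)
  have deg: "degree (char_poly A) = Suc (degree (\<Prod>e\<leftarrow>es. [:- e, 1:]))"
    unfolding cp using mon by (subst degree_mult_eq) auto
  define m where "m = n - 1"
  have n: "n = 1 + m" using deg degree_monic_char_poly[OF A] by (simp add: m_def)
  have "eigenvalue A e" unfolding eigenvalue_root_char_poly[OF A] cp by simp
  then obtain v where v: "v \<in> carrier_vec n" "v \<noteq> 0\<^sub>v n" "A *\<^sub>v v = e \<cdot>\<^sub>v v"
    using A unfolding eigenvalue_def eigenvector_def by auto
  obtain W c where W: "unitary_mat n W" and col: "col W 0 = c \<cdot>\<^sub>v v"
    using unitary_first_column[OF v(1,2)] by blast
  have Wc: "W \<in> carrier_mat n n" using W by (rule unitary_carrier)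
  define A' where "A' = mat_adjoint W * A * W"
  have A': "A' \<in> carrier_mat n n" using A Wc by (simp add: A'_def)
  have A'W: "A' = mat_adjoint W * (A * W)"
    using A Wc by (simp add: A'_def mult_assoc_square[of _ n])
  have nA': "normal_mat A'" unfolding A'_def using W A Cons.prems(2) by (rule normal_unitary_conjugate)
  have AW: "A = W * A' * mat_adjoint W"
    using A Wc W by (simp add: A'_def mult_assoc_square[of _ n] unitary_cancel[of n])
       (simp add: unitary_mat_def)
  have "col (A * W) 0 = A *\<^sub>v (c \<cdot>\<^sub>v v)"
    using col_mult2[OF A Wc, of 0] n col by simp
  also have "\<dots> = c \<cdot>\<^sub>v (e \<cdot>\<^sub>v v)" unfolding mult_mat_vec[OF A v(1)] v(3) ..
  also have "\<dots> = e \<cdot>\<^sub>v col W 0" unfolding col smult_smult_assoc by (simp add: mult.commute)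
  finally have "col (A * W) 0 = e \<cdot>\<^sub>v col W 0" .
  then have AW0: "(A * W) $$ (k,0) = e * W $$ (k,0)" if "k < n" for k
    using that n A Wc by (metis carrier_matD col_def dim_col index_mult_mat(2) index_smult_vec(1) index_vec plus_1_eq_Suc zero_less_Suc)
  have A'0: "A' $$ (i,0) = (if i = 0 then e else 0)" if i: "i < n" for i
  proof -
    have "A' $$ (i,0) = (\<Sum>k<n. mat_adjoint W $$ (i,k) * (A * W) $$ (k,0))"
      unfolding A'W using i n A Wc by (intro mult_entry) auto
    also have "\<dots> = e * (\<Sum>k<n. mat_adjoint W $$ (i,k) * W $$ (k,0))"
      unfolding sum_distrib_left by (intro sum.cong) (auto simp: AW0)
    also have "(\<Sum>k<n. mat_adjoint W $$ (i,k) * W $$ (k,0)) = (mat_adjoint W * W) $$ (i,0)"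
      using i n Wc by (subst mult_entry[of _ n n _ n]) auto
    also have "\<dots> = (if i = 0 then 1 else 0)" using W i n by (simp add: unitary_mat_def)
    finally show ?thesis by simp
  qed
  have A'r: "A' $$ (0,j) = 0" if "0 < j" "j < n" for j
    using A' nA' A'0 that by (intro normal_column_forces_row[of A' n]) auto
  define A1 where "A1 = mat 1 1 (\<lambda>_. e)"
  define A3 where "A3 = mat m m (\<lambda>(i,j). A' $$ (Suc i, Suc j))"
  have A1c: "A1 \<in> carrier_mat 1 1" and A3c: "A3 \<in> carrier_mat m m" by (auto simp: A1_def A3_def)
  have blk: "A' = four_block_mat A1 (0\<^sub>m 1 m) (0\<^sub>m m 1) A3"
    using A' n by (intro eq_matI) (auto simp: A1_def A3_def A'0 A'r)
  have "normal_mat A3"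
  proof -
    have "mat_adjoint A' * A' = A' * mat_adjoint A'" using nA' by (simp add: normal_mat_def)
    then have "four_block_mat (mat_adjoint A1 * A1) (0\<^sub>m 1 m) (0\<^sub>m m 1) (mat_adjoint A3 * A3)
       = four_block_mat (A1 * mat_adjoint A1) (0\<^sub>m 1 m) (0\<^sub>m m 1) (A3 * mat_adjoint A3)"
      unfolding blk using A1c A3c by (simp add: adjoint_block_diag mult_block_diag)
    then have "mat_adjoint A3 * A3 = A3 * mat_adjoint A3"
      by (rule four_block_lower_right_eq[where ?n1.0 = 1 and ?m1.0 = 1 and ?n2.0 = m and ?m2.0 = m, rotated -1]) (use A1c A3c in auto)
    then show ?thesis using A3c by (simp add: normal_mat_def)
  qed
  moreover have "char_poly A3 = (\<Prod>e\<leftarrow>es. [:- e, 1:])"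
  proof -
    have "similar_mat_wit A A' W (mat_adjoint W)"
      by (rule similar_mat_witI[OF _ _ AW A A' Wc]) (use W in \<open>auto simp: unitary_mat_def\<close>)
    then have "char_poly A = char_poly A'" by (intro char_poly_similar) (auto simp: similar_mat_def)
    also have "\<dots> = char_poly A1 * char_poly A3"
      unfolding blk by (rule char_poly_four_block_zeros_col) (use A1c A3c in auto)
    also have "char_poly A1 = [: -e,1 :]"
      by (simp add: A1_def char_poly_defs det_def sign_def)
    finally show ?thesis using cp by (metis mult_cancel_left pCons_eq_0_iff zero_neq_one)
  qed
  ultimately obtain U where U: "unitary_mat m U" and A3U: "A3 = U * mat_diag m ((!) es) * mat_adjoint U"
    using Cons.IH[OF A3c] by blast
  have Uc: "U \<in> carrier_mat m m" using U by (rule unitary_carrier)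
  define V where "V = four_block_mat (1\<^sub>m 1) (0\<^sub>m 1 m) (0\<^sub>m m 1) U"
  have aV: "mat_adjoint V = four_block_mat (1\<^sub>m 1) (0\<^sub>m 1 m) (0\<^sub>m m 1) (mat_adjoint U)"
    unfolding V_def using Uc by (simp add: adjoint_block_diag)
  have V: "unitary_mat n V"
    using U Uc by (intro unitary_matI, unfold aV, unfold V_def n)
      (auto simp: mult_block_diag unitary_mat_def)
  have D: "mat_diag n ((!) (e # es)) = four_block_mat A1 (0\<^sub>m 1 m) (0\<^sub>m m 1) (mat_diag m ((!) es))"
    by (rule eq_matI) (auto simp: mat_diag_def A1_def n)
  have "A' = V * mat_diag n ((!) (e # es)) * mat_adjoint V"
    unfolding D aV unfolding V_def blk using Uc A1c A3c A3U by (simp add: mult_block_diag)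
  then have "A = (W * V) * mat_diag n ((!) (e # es)) * mat_adjoint (W * V)"
    using W V AW by (auto simp: unitary_carrier adjoint_mult_square[of _ n] mult_assoc_square[of _ n])
  then show ?case using unitary_mult[OF W V] by blast
qed


lemma normal_spectral_exists:
  assumes "A \<in> carrier_mat n n" "normal_mat A"
  shows "\<exists>U d. unitary_mat n U \<and> A = U * mat_diag n d * mat_adjoint U"
  using char_poly_factorized[OF assms(1)] normal_spectral[OF assms] by blast

section \<open>Singular value decomposition\<close>

text \<open>Both sides are determinants of one block matrix, once evaluated as
  \<open>det (\<lambda>I * I - A * B)\<close> and once, after swapping the blocks, as \<open>det (I * \<lambda>I - B * A)\<close>.\<close>

lemma char_poly_mult_commute:
  fixes A B :: "complex mat"
  assumes A: "A \<in> carrier_mat n n" and B: "B \<in> carrier_mat n n"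
  shows "char_poly (A * B) = char_poly (B * A)"
proof -
  define a where "a = map_mat (\<lambda>c. [:c:]) A"
  define b where "b = map_mat (\<lambda>c. [:c:]) B"
  define X where "X = ([:0,1:] :: complex poly) \<cdot>\<^sub>m 1\<^sub>m n"
  define J :: "complex poly mat" where "J = four_block_mat (0\<^sub>m n n) (1\<^sub>m n) (1\<^sub>m n) (0\<^sub>m n n)"
  have c: "a \<in> carrier_mat n n" "b \<in> carrier_mat n n" "X \<in> carrier_mat n n" "J \<in> carrier_mat (n+n) (n+n)"
    using A B by (auto simp: a_def b_def X_def J_def)
  have const_sum: "(\<Sum>k\<in>K. [:f k:]) = [:\<Sum>k\<in>K. f k:]" for f :: "nat \<Rightarrow> complex" and K
    by (induction K rule: infinite_finite_induct) auto
  have cpm: "char_poly_matrix (C * D) = X - map_mat (\<lambda>c. [:c:]) C * map_mat (\<lambda>c. [:c:]) D"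
    if "C \<in> carrier_mat n n" "D \<in> carrier_mat n n" for C D :: "complex mat"
    using that by (intro eq_matI)
      (auto simp: char_poly_matrix_def X_def scalar_prod_def const_sum mult.commute)
  have "det (four_block_mat X a b (1\<^sub>m n)) = det (X * 1\<^sub>m n - a * b)"
    using c by (intro det_four_block_mat) auto
  then have 1: "det (four_block_mat X a b (1\<^sub>m n)) = char_poly (A * B)"
    using c cpm[OF A B] by (simp add: char_poly_def a_def b_def)
  have "a * X = X * a"
    using c(1) by (simp add: X_def mult_smult_distrib[of _ n n _ n] mult_smult_assoc_mat[of _ n n _ n])
  then have "det (four_block_mat (1\<^sub>m n) b a X) = det (1\<^sub>m n * X - b * a)"
    using c by (intro det_four_block_mat) auto
  then have 2: "det (four_block_mat (1\<^sub>m n) b a X) = char_poly (B * A)"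
    using c cpm[OF B A] by (simp add: char_poly_def a_def b_def)
  have Bc: "four_block_mat X a b (1\<^sub>m n) \<in> carrier_mat (n+n) (n+n)"
    using c by (intro four_block_carrier_mat) auto
  have JJ: "J * J = 1\<^sub>m (n+n)"
    unfolding J_def by (simp add: mult_four_block_mat[of _ n n _ n _ n _ _ n _ n])
  have "four_block_mat (1\<^sub>m n) b a X = J * (four_block_mat X a b (1\<^sub>m n) * J)"
    unfolding J_def using c by (simp add: mult_four_block_mat[of _ n n _ n _ n _ _ n _ n])
  also have "det \<dots> = det J * (det (four_block_mat X a b (1\<^sub>m n)) * det J)"
    using det_mult[OF c(4) mult_carrier_mat[OF Bc c(4)]] det_mult[OF Bc c(4)] by simp
  also have "\<dots> = det (J * J) * det (four_block_mat X a b (1\<^sub>m n))"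
    using det_mult[OF c(4) c(4)] by (simp add: mult_ac)
  finally show ?thesis using 1 2 JJ by simp
qed

lemma hermitian_normal:
  assumes "A \<in> carrier_mat n n" "mat_adjoint A = A"
  shows "normal_mat A"
  using assms by (simp add: normal_mat_def)

text \<open>The matrices \<open>Z\<^sup>* Z\<close> and \<open>Z Z\<^sup>*\<close> have the same characteristic polynomial, so they equal
  \<open>W\<^sub>2 D W\<^sub>2\<^sup>*\<close> and \<open>W\<^sub>1 D W\<^sub>1\<^sup>*\<close> with the same diagonal \<open>D\<close>. Then \<open>M = W\<^sub>1\<^sup>* Z W\<^sub>2\<close> satisfies
  \<open>M\<^sup>* M = D = M M\<^sup>*\<close>: every square matrix is unitarily equivalent to a normal one. Diagonalising
  \<open>M\<close> and moving the phases of its eigenvalues into a unitary factor gives the decomposition,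
  without treating singular matrices separately.\<close>

theorem singular_value_decomposition:
  assumes Z: "Z \<in> carrier_mat n n"
  shows "\<exists>U V s. unitary_mat n U \<and> unitary_mat n V \<and> (\<forall>i. 0 \<le> s i)
    \<and> Z = U * mat_diag n (\<lambda>i. complex_of_real (s i)) * V"
proof -
  let ?L = "mat_adjoint Z * Z" and ?R = "Z * mat_adjoint Z"
  have L: "?L \<in> carrier_mat n n" "normal_mat ?L" and R: "?R \<in> carrier_mat n n" "normal_mat ?R"
    using Z by (auto intro!: hermitian_normal[of _ n] simp: adjoint_mult_square[of _ n])
  obtain es where es: "char_poly ?L = (\<Prod>e\<leftarrow>es. [:- e, 1:])"
    using char_poly_factorized[OF L(1)] by blast
  then have es': "char_poly ?R = (\<Prod>e\<leftarrow>es. [:- e, 1:])"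
    using char_poly_mult_commute[of Z n "mat_adjoint Z"] Z by simp
  define D where "D = mat_diag n ((!) es)"
  obtain W2 where W2: "unitary_mat n W2" and LW: "?L = W2 * D * mat_adjoint W2"
    using normal_spectral[OF L es] unfolding D_def by blast
  obtain W1 where W1: "unitary_mat n W1" and RW: "?R = W1 * D * mat_adjoint W1"
    using normal_spectral[OF R es'] unfolding D_def by blast
  have c: "W1 \<in> carrier_mat n n" "W2 \<in> carrier_mat n n" "D \<in> carrier_mat n n"
    using W1 W2 by (auto simp: unitary_carrier D_def)
  define M where "M = mat_adjoint W1 * Z * W2"
  have M: "M \<in> carrier_mat n n" using c Z by (simp add: M_def)
  have "mat_adjoint M * M = mat_adjoint W2 * ?L * W2"
    using c Z W1 by (simp add: M_def adjoint_mult_square[of _ n] mult_assoc_square[of _ n] unitary_cancel[of n])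
  also have "\<dots> = D" unfolding LW using c W2
    by (simp add: mult_assoc_square[of _ n] unitary_cancel[of n]) (simp add: unitary_mat_def)
  finally have 1: "mat_adjoint M * M = D" .
  have "M * mat_adjoint M = mat_adjoint W1 * ?R * W1"
    using c Z W2 by (simp add: M_def adjoint_mult_square[of _ n] mult_assoc_square[of _ n] unitary_cancel[of n])
  also have "\<dots> = D" unfolding RW using c W1
    by (simp add: mult_assoc_square[of _ n] unitary_cancel[of n]) (simp add: unitary_mat_def)
  finally have "normal_mat M" using 1 M by (simp add: normal_mat_def)
  then obtain W d where W: "unitary_mat n W" and MW: "M = W * mat_diag n d * mat_adjoint W"
    using normal_spectral_exists[OF M] by blast
  \<comment> \<open>the value at a zero eigenvalue is arbitrary of modulus 1; \<open>sgn 0 = 0\<close> would break unitarity\<close>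
  define ph where "ph = (\<lambda>i. if d i = 0 then 1 else sgn (d i))"
  have ph: "unitary_mat n (mat_diag n ph)"
    by (rule unitary_mat_diag) (simp add: ph_def norm_sgn)
  have d: "mat_diag n d = mat_diag n ph * mat_diag n (\<lambda>i. complex_of_real (cmod (d i)))"
    unfolding mat_diag_diag by (rule arg_cong[of _ _ "mat_diag n"]) (auto simp: ph_def sgn_eq)
  have Wc: "W \<in> carrier_mat n n" using W by (rule unitary_carrier)
  have "Z = W1 * M * mat_adjoint W2"
    using c Z W1 W2 by (simp add: M_def mult_assoc_square[of _ n] unitary_cancel[of n])
      (simp add: unitary_mat_def)
  also have "\<dots> = (W1 * (W * mat_diag n ph)) * mat_diag n (\<lambda>i. complex_of_real (cmod (d i)))
      * (mat_adjoint W * mat_adjoint W2)"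
    unfolding MW d using c Wc by (simp add: mult_assoc_square[of _ n] del: mat_diag_diag)
  finally show ?thesis
    using unitary_mult[OF W1 unitary_mult[OF W ph]] unitary_mult[OF unitary_adjoint[OF W] unitary_adjoint[OF W2]]
    by (intro exI[of _ "W1 * (W * mat_diag n ph)"] exI[of _ "mat_adjoint W * mat_adjoint W2"]
        exI[of _ "\<lambda>i. cmod (d i)"]) auto
qed

section \<open>Positive semidefinite matrices and their square roots\<close>

lemma gram_diagonal:
  assumes "X \<in> carrier_mat n n" "i < n"
  shows "(mat_adjoint X * X) $$ (i,i) = complex_of_real (\<Sum>k<n. (cmod (X $$ (k,i)))\<^sup>2)"
  using assms by (subst mult_entry[of _ n n _ n]) (auto simp: cmod_square_eq mult.commute)

lemma adjoint_inner:
  assumes A: "(A :: complex mat) \<in> carrier_mat n m" and w: "w \<in> carrier_vec n" and v: "v \<in> carrier_vec m"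
  shows "(mat_adjoint A *\<^sub>v w) \<bullet>c v = w \<bullet>c (A *\<^sub>v v)"
proof -
  have e1: "(mat_adjoint A *\<^sub>v w) $ i = (\<Sum>k<n. cnj (A $$ (k,i)) * w $ k)" if "i < m" for i
    using that A w by (auto simp: scalar_prod_def atLeast0LessThan intro!: sum.cong)
  have e2: "(A *\<^sub>v v) $ k = (\<Sum>i<m. A $$ (k,i) * v $ i)" if "k < n" for k
    using that A v by (auto simp: scalar_prod_def atLeast0LessThan intro!: sum.cong)
  have "(mat_adjoint A *\<^sub>v w) \<bullet>c v = (\<Sum>i<m. (\<Sum>k<n. cnj (A $$ (k,i)) * w $ k) * cnj (v $ i))"
    using A v w e1 by (subst cscalar_prod_sum[of _ m]) (auto intro!: mult_mat_vec_carrier[of _ m n])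
  also have "\<dots> = (\<Sum>k<n. \<Sum>i<m. cnj (A $$ (k,i)) * w $ k * cnj (v $ i))"
    unfolding sum_distrib_right by (rule sum.swap)
  also have "\<dots> = (\<Sum>k<n. w $ k * cnj (\<Sum>i<m. A $$ (k,i) * v $ i))"
    by (simp add: sum_distrib_left mult_ac)
  also have "\<dots> = w \<bullet>c (A *\<^sub>v v)"
    using A v w e2 by (subst cscalar_prod_sum[of _ n]) (auto intro!: mult_mat_vec_carrier[of _ n m])
  finally show ?thesis .
qed

lemma psd_gram:
  assumes X: "X \<in> carrier_mat n n"
  shows "psd_mat n (mat_adjoint X * X)"
  unfolding psd_mat_def
proof (intro conjI ballI)
  show "mat_adjoint X * X \<in> carrier_mat n n" "mat_adjoint (mat_adjoint X * X) = mat_adjoint X * X"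
    using X by (auto simp: adjoint_mult_square[of _ n])
  fix v :: "complex vec" assume v: "v \<in> carrier_vec n"
  have "(mat_adjoint X * X *\<^sub>v v) \<bullet>c v = (X *\<^sub>v v) \<bullet>c (X *\<^sub>v v)"
    using X v by (simp add: assoc_mult_mat_vec[of _ n n _ n] adjoint_inner[of _ n n])
  also have "\<dots> = (\<Sum>k<n. complex_of_real ((cmod ((X *\<^sub>v v) $ k))\<^sup>2))"
    using X v by (subst cscalar_prod_sum[of _ n]) (auto simp: cmod_square_eq)
  also have "Re \<dots> \<ge> 0" by (simp add: sum_nonneg)
  finally show "0 \<le> Re ((mat_adjoint X * X *\<^sub>v v) \<bullet>c v)" .
qed

lemma psd_add:
  assumes "psd_mat n P" "psd_mat n Q"
  shows "psd_mat n (P + Q)"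
  using assms
  by (auto simp: psd_mat_def adjoint_add[of _ n n] add_mult_distrib_mat_vec[of _ n n] add_scalar_prod_distrib[of _ n])

text \<open>The eigenvalues are the values of the quadratic form at the columns of \<open>U\<close>, hence nonnegative.\<close>

lemma psd_spectral:
  assumes P: "psd_mat n P"
  shows "\<exists>U p. unitary_mat n U \<and> (\<forall>i<n. 0 \<le> p i)
    \<and> P = U * mat_diag n (\<lambda>i. complex_of_real (p i)) * mat_adjoint U"
proof -
  have Pc: "P \<in> carrier_mat n n" and Ph: "mat_adjoint P = P" using P by (auto simp: psd_mat_def)
  obtain U d where U: "unitary_mat n U" and PU: "P = U * mat_diag n d * mat_adjoint U"
    using normal_spectral_exists[OF Pc hermitian_normal[OF Pc Ph]] by blast
  have Uc: "U \<in> carrier_mat n n" using U by (rule unitary_carrier)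
  have D: "mat_diag n d = mat_adjoint U * (P * U)"
    unfolding PU using U Uc
    by (simp add: mult_assoc_square[of _ n] unitary_cancel[of n])
       (simp add: unitary_mat_def right_mult_one_mat[of _ n n])
  have "mat_adjoint (mat_diag n d) = mat_diag n d"
    unfolding D using Uc Pc Ph by (simp add: adjoint_mult_square[of _ n] mult_assoc_square[of _ n])
  then have ent: "mat_diag n (\<lambda>i. cnj (d i)) $$ (i,i) = mat_diag n d $$ (i,i)" for i by simp
  have "cnj (d i) = d i" if "i < n" for i using ent[of i] that by (simp add: mat_diag_def)
  then have real: "d i = complex_of_real (Re (d i))" if "i < n" for i
    using that by (simp add: complex_eq_iff)
  have "0 \<le> Re (d i)" if i: "i < n" for i
  proof -
    have "d i = (mat_adjoint U * (P * U)) $$ (i,i)"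
      using i unfolding D[symmetric] by (simp add: mat_diag_def)
    also have "\<dots> = (\<Sum>k<n. cnj (U $$ (k,i)) * (P * U) $$ (k,i))"
      using i Uc Pc by (subst mult_entry[of _ n n _ n]) auto
    also have "\<dots> = (P *\<^sub>v col U i) \<bullet>c col U i"
      using i Uc Pc by (subst cscalar_prod_sum[of _ n]) (auto simp: mult.commute)
    finally show ?thesis using P i Uc by (simp add: psd_mat_def)
  qed
  moreover have "mat_diag n d = mat_diag n (\<lambda>i. complex_of_real (Re (d i)))"
    by (rule eq_matI) (auto simp: mat_diag_def intro: real)
  ultimately show ?thesis using U PU by (intro exI[of _ U] exI[of _ "\<lambda>i. Re (d i)"]) simp
qed

lemma psd_hermitian_root:
  assumes "psd_mat n P"
  shows "\<exists>R \<in> carrier_mat n n. mat_adjoint R = R \<and> R * R = P"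
proof -
  obtain U p where U: "unitary_mat n U" and p: "\<forall>i<n. 0 \<le> p i"
    and PU: "P = U * mat_diag n (\<lambda>i. complex_of_real (p i)) * mat_adjoint U"
    using psd_spectral[OF assms] by blast
  have Uc: "U \<in> carrier_mat n n" using U by (rule unitary_carrier)
  let ?S = "mat_diag n (\<lambda>i. complex_of_real (sqrt (p i)))"
  have "?S * ?S = mat_diag n (\<lambda>i. complex_of_real (p i))"
    unfolding mat_diag_diag
    by (rule eq_matI) (use p in \<open>auto simp: mat_diag_def simp flip: of_real_mult\<close>)
  then have "?S * (?S * X) = mat_diag n (\<lambda>i. complex_of_real (p i)) * X" if "X \<in> carrier_mat n n" for X
    using that by (simp flip: mult_assoc_square[of _ n])
  then show ?thesis
    unfolding PU using U Uc
    by (intro bexI[of _ "U * ?S * mat_adjoint U"])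
       (simp_all add: adjoint_mult_square[of _ n] mult_assoc_square[of _ n] unitary_cancel[of n])
qed

text \<open>Diagonalise \<open>P = U p U\<^sup>*\<close> and \<open>Q = V q V\<^sup>*\<close>. In terms of \<open>G = U\<^sup>* V\<close>, equality of the squares says
  \<open>(p\<^sub>i\<^sup>2 - q\<^sub>j\<^sup>2) G\<^sub>i\<^sub>j = 0\<close>; since \<open>p\<close> and \<open>q\<close> are nonnegative, also \<open>(p\<^sub>i - q\<^sub>j) G\<^sub>i\<^sub>j = 0\<close>, which is
  equality of \<open>P\<close> and \<open>Q\<close>.\<close>

lemma psd_root_unique:
  assumes P: "psd_mat n P" and Q: "psd_mat n Q" and eq: "P * P = Q * Q"
  shows "P = Q"
proof -
  obtain U p where U: "unitary_mat n U" and p: "\<forall>i<n. 0 \<le> p i"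
    and PU: "P = U * mat_diag n (\<lambda>i. complex_of_real (p i)) * mat_adjoint U"
    using psd_spectral[OF P] by blast
  obtain V q where V: "unitary_mat n V" and q: "\<forall>i<n. 0 \<le> q i"
    and QV: "Q = V * mat_diag n (\<lambda>i. complex_of_real (q i)) * mat_adjoint V"
    using psd_spectral[OF Q] by blast
  let ?p = "mat_diag n (\<lambda>i. complex_of_real (p i))" and ?q = "mat_diag n (\<lambda>i. complex_of_real (q i))"
  have c: "U \<in> carrier_mat n n" "V \<in> carrier_mat n n" using U V by (auto simp: unitary_carrier)
  define G where "G = mat_adjoint U * V"
  have G: "G \<in> carrier_mat n n" using c by (simp add: G_def)
  have "mat_adjoint U * (P * P) * V = ?p * ?p * G"
    unfolding PU G_def using c U V
    by (simp add: mult_assoc_square[of _ n] unitary_cancel[of n] del: mat_diag_diag)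
  moreover have "mat_adjoint U * (Q * Q) * V = G * (?q * ?q)"
    unfolding QV G_def using c U V
    by (simp add: mult_assoc_square[of _ n] unitary_cancel[of n] del: mat_diag_diag)
       (simp add: unitary_mat_def right_mult_one_mat[of _ n n])
  ultimately have "?p * ?p * G = G * (?q * ?q)" using eq by simp
  then have sq: "(?p * ?p * G) $$ (i,j) = (G * (?q * ?q)) $$ (i,j)" for i j by simp
  have "?p * G = G * ?q"
  proof (rule eq_matI)
    fix i j assume "i < dim_row (G * ?q)" "j < dim_col (G * ?q)"
    then have ij: "i < n" "j < n" using G by (auto simp: mat_diag_def)
    have "complex_of_real (p i * p i) * G $$ (i,j) = G $$ (i,j) * complex_of_real (q j * q j)"
      using sq[of i j] ij G by (simp add: mat_diag_mult_left[of _ n n] mat_diag_mult_right[of _ n n])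
    then have "G $$ (i,j) = 0 \<or> complex_of_real (p i * p i) = complex_of_real (q j * q j)" by auto
    then have "G $$ (i,j) = 0 \<or> p i = q j"
      using p q ij by (metis of_real_eq_iff power2_eq_square power2_eq_imp_eq)
    then show "(?p * G) $$ (i,j) = (G * ?q) $$ (i,j)"
      using ij G by (auto simp: mat_diag_mult_left[of _ n n] mat_diag_mult_right[of _ n n])
  qed (use G in \<open>auto simp: mat_diag_def\<close>)
  then have "U * (?p * G) * mat_adjoint V = U * (G * ?q) * mat_adjoint V" by simp
  then show ?thesis
    unfolding PU QV G_def using c U V
    by (simp add: mult_assoc_square[of _ n] unitary_cancel[of n]) (simp add: unitary_mat_def)
qed

lemma mat_abs_eqI:
  assumes Y: "Y \<in> carrier_mat n n" and M: "psd_mat n M" and eq: "M * M = mat_adjoint Y * Y"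
  shows "mat_abs Y = M"
  unfolding mat_abs_def psd_sqrt_def
proof (rule the_equality)
  show "psd_mat (dim_row (mat_adjoint Y * Y)) M \<and> M * M = mat_adjoint Y * Y" using assms by simp
  show "P = M" if "psd_mat (dim_row (mat_adjoint Y * Y)) P \<and> P * P = mat_adjoint Y * Y" for P
    using psd_root_unique[of n P M] that assms by simp
qed

text \<open>The modulus of the eigenvalues is shared equally between the two factors and the phase is given to
  the second one. The phase commutes with the modulus, so it cancels in \<open>Y\<^sup>* Y\<close>.\<close>

lemma normal_factorization:
  assumes A: "A \<in> carrier_mat n n" and nA: "normal_mat A"
  obtains X Y where "X \<in> carrier_mat n n" "Y \<in> carrier_mat n n" "A = mat_adjoint X * Y"
    "mat_adjoint X * X = mat_abs A" "mat_adjoint Y * Y = mat_abs A"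
proof -
  obtain W d where W: "unitary_mat n W" and AW: "A = W * mat_diag n d * mat_adjoint W"
    using normal_spectral_exists[OF A nA] by blast
  have Wc: "W \<in> carrier_mat n n" using W by (rule unitary_carrier)
  define x where "x = (\<lambda>i. complex_of_real (sqrt (cmod (d i))))"
  define y where "y = (\<lambda>i. sgn (d i) * complex_of_real (sqrt (cmod (d i))))"
  have "cnj (x i) * x i = complex_of_real (cmod (d i))" for i
    by (simp add: x_def flip: of_real_mult)
  moreover have "cnj (x i) * y i = d i" for i
  proof -
    have "cnj (x i) * y i = sgn (d i) * complex_of_real (sqrt (cmod (d i)) * sqrt (cmod (d i)))"
      by (simp add: x_def y_def flip: of_real_mult)
    then show ?thesis by (simp add: sgn_eq)
  qed
  moreover have "cnj (y i) * y i = complex_of_real (cmod (d i))" for i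
  proof -
    have "cnj (y i) * y i = cnj (sgn (d i)) * sgn (d i) * complex_of_real (cmod (d i))"
      by (simp add: y_def flip: of_real_mult)
    also have "cnj (sgn (d i)) * sgn (d i) = (complex_of_real (cmod (sgn (d i))))\<^sup>2"
      by (simp add: cmod_square_eq mult.commute)
    finally show ?thesis by (simp add: norm_sgn)
  qed
  moreover have "complex_of_real (cmod (d i)) * complex_of_real (cmod (d i)) = cnj (d i) * d i" for i
    using cmod_square_eq[of "d i"] by (simp add: power2_eq_square mult.commute)
  ultimately have e: "mat_diag n (\<lambda>i. cnj (x i)) * (mat_diag n x * Z) = mat_diag n (\<lambda>i. complex_of_real (cmod (d i))) * Z"
    "mat_diag n (\<lambda>i. cnj (x i)) * (mat_diag n y * Z) = mat_diag n d * Z"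
    "mat_diag n (\<lambda>i. cnj (y i)) * (mat_diag n y * Z) = mat_diag n (\<lambda>i. complex_of_real (cmod (d i))) * Z"
    "mat_diag n (\<lambda>i. complex_of_real (cmod (d i))) * (mat_diag n (\<lambda>i. complex_of_real (cmod (d i))) * Z)
      = mat_diag n (\<lambda>i. cnj (d i)) * (mat_diag n d * Z)"
    if "Z \<in> carrier_mat n n" for Z
    using that by (simp_all flip: mult_assoc_square[of _ n])
  define X where "X = mat_diag n x * mat_adjoint W"
  define Y where "Y = mat_diag n y * mat_adjoint W"
  define M where "M = W * mat_diag n (\<lambda>i. complex_of_real (cmod (d i))) * mat_adjoint W"
  have c: "X \<in> carrier_mat n n" "Y \<in> carrier_mat n n" using Wc by (auto simp: X_def Y_def)
  note s = adjoint_mult_square[of _ n] mult_assoc_square[of _ n] unitary_cancel[of n] e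
  have XX: "mat_adjoint X * X = M" using Wc by (simp add: X_def M_def s)
  have YY: "mat_adjoint Y * Y = M" using Wc by (simp add: Y_def M_def s)
  have XY: "A = mat_adjoint X * Y" using Wc by (simp add: X_def Y_def AW s)
  have "M * M = mat_adjoint A * A" using Wc W by (simp add: M_def AW s)
  then have "mat_abs A = M" using psd_gram[OF c(1)] A by (intro mat_abs_eqI) (auto simp: XX)
  then show ?thesis using that c XX YY XY by simp
qed


section \<open>Unitarily invariant norms\<close>

lemma symmetric_norm_scale:
  "symmetric_norm m N \<Longrightarrow> X \<in> carrier_mat m m \<Longrightarrow> N (c \<cdot>\<^sub>m X) = cmod c * N X"
  by (simp add: symmetric_norm_def)

lemma symmetric_norm_triangle:
  "symmetric_norm m N \<Longrightarrow> X \<in> carrier_mat m m \<Longrightarrow> Y \<in> carrier_mat m m \<Longrightarrow> N (X + Y) \<le> N X + N Y"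
  by (simp add: symmetric_norm_def)

lemma symmetric_norm_unitary:
  "symmetric_norm m N \<Longrightarrow> X \<in> carrier_mat m m \<Longrightarrow> unitary_mat m U \<Longrightarrow> unitary_mat m V
    \<Longrightarrow> N (U * X * V) = N X"
  by (simp add: symmetric_norm_def)

lemma symmetric_norm_midpoint:
  assumes N: "symmetric_norm m N" and "X \<in> carrier_mat m m" "Y \<in> carrier_mat m m"
    and "N X \<le> c" "N Y \<le> c"
  shows "N ((1/2) \<cdot>\<^sub>m (X + Y)) \<le> c"
proof -
  have "N ((1/2) \<cdot>\<^sub>m (X + Y)) = 1/2 * N (X + Y)"
    using assms by (subst symmetric_norm_scale[OF N]) auto
  also have "\<dots> \<le> 1/2 * (N X + N Y)"
    using symmetric_norm_triangle[OF N, of X Y] assms by simp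
  finally show ?thesis using assms by simp
qed

lemma mat_diag_conjugate_entry:
  assumes "X \<in> carrier_mat n n" "i < n" "j < n"
  shows "(mat_diag n f * X * mat_diag n g) $$ (i,j) = f i * X $$ (i,j) * g j"
  using assms by (simp add: mat_diag_mult_left[of _ n n] mat_diag_mult_right[of _ n n])

text \<open>A number \<open>t\<close> in \<open>[0, 1]\<close> is the mean of the unimodular numbers \<open>t \<plusminus> \<i> sqrt(1 - t\<^sup>2)\<close>, so the
  smaller diagonal matrix is the mean of two products of the larger one with diagonal unitaries.\<close>

lemma symmetric_norm_diag_mono:
  assumes N: "symmetric_norm m N" and de: "\<And>i. i < m \<Longrightarrow> 0 \<le> d i \<and> d i \<le> e i"
  shows "N (mat_diag m (\<lambda>i. complex_of_real (d i))) \<le> N (mat_diag m (\<lambda>i. complex_of_real (e i)))"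
proof -
  \<comment> \<open>if \<open>e i = 0\<close> then \<open>d i = 0\<close>, and \<open>t i = 0 / 0 = 0\<close> still satisfies \<open>d i = t i * e i\<close>\<close>
  define t where "t = (\<lambda>i. d i / e i)"
  define u where "u = (\<lambda>i. Complex (t i) (sqrt (1 - (t i)\<^sup>2)))"
  have t: "0 \<le> t i \<and> t i \<le> 1" "d i = t i * e i" if "i < m" for i
    using de[OF that] by (auto simp: t_def divide_le_eq_1 split: if_splits)
  have u: "cmod (u i) = 1" if "i < m" for i
    using t[OF that] power_le_one[of "t i" 2] by (simp add: u_def cmod_def)
  let ?E = "mat_diag m (\<lambda>i. complex_of_real (e i))"
  have U: "unitary_mat m (mat_diag m u)" "unitary_mat m (mat_diag m (\<lambda>i. cnj (u i)))"
    by (auto intro!: unitary_mat_diag simp: u)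
  have "N (mat_diag m u * ?E * 1\<^sub>m m) = N ?E" "N (mat_diag m (\<lambda>i. cnj (u i)) * ?E * 1\<^sub>m m) = N ?E"
    using symmetric_norm_unitary[OF N mat_diag_dim U(1) unitary_one]
      symmetric_norm_unitary[OF N mat_diag_dim U(2) unitary_one] by blast+
  then have "N ((1/2) \<cdot>\<^sub>m (mat_diag m u * ?E * 1\<^sub>m m + mat_diag m (\<lambda>i. cnj (u i)) * ?E * 1\<^sub>m m)) \<le> N ?E"
    by (intro symmetric_norm_midpoint[OF N]) auto
  also have "(1/2) \<cdot>\<^sub>m (mat_diag m u * ?E * 1\<^sub>m m + mat_diag m (\<lambda>i. cnj (u i)) * ?E * 1\<^sub>m m)
      = mat_diag m (\<lambda>i. complex_of_real (d i))"
    unfolding mat_diag_diag right_mult_one_mat[OF mat_diag_dim]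
    by (rule eq_matI) (auto simp: mat_diag_def u_def complex_eq_iff t(2))
  finally show ?thesis .
qed

text \<open>Averaging with the conjugate by the unitary that flips the sign of coordinate \<open>k\<close> erases the
  off-diagonal entries of row and column \<open>k\<close>; doing so for each \<open>k\<close> leaves the diagonal.\<close>

lemma symmetric_norm_pinching:
  assumes N: "symmetric_norm m N" and H: "H \<in> carrier_mat m m"
  shows "N (mat_diag m (\<lambda>i. H $$ (i,i))) \<le> N H"
proof -
  \<comment> \<open>\<open>H\<close> after coordinates \<open>0, \<dots>, k - 1\<close> have been decoupled\<close>
  define K where "K = (\<lambda>k. mat m m (\<lambda>(i,j). if i = j \<or> k \<le> i \<and> k \<le> j then H $$ (i,j) else 0))"
  have Kc: "K k \<in> carrier_mat m m" for k by (simp add: K_def)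
  have "N (K k) \<le> N H" if "k \<le> m" for k
    using that
  proof (induction k)
    case 0
    have "K 0 = H" using H by (intro eq_matI) (auto simp: K_def)
    then show ?case by simp
  next
    case (Suc k)
    define S where "S = mat_diag m (\<lambda>i. if i = k then -1 else (1::complex))"
    have S: "unitary_mat m S" unfolding S_def by (rule unitary_mat_diag) auto
    have "K (Suc k) = (1/2) \<cdot>\<^sub>m (K k + S * K k * S)"
    proof (rule eq_matI)
      fix i j assume "i < dim_row ((1/2) \<cdot>\<^sub>m (K k + S * K k * S))" "j < dim_col ((1/2) \<cdot>\<^sub>m (K k + S * K k * S))"
      then have ij: "i < m" "j < m" by (auto simp: S_def mat_diag_def)
      then have "(S * K k * S) $$ (i,j) = (if i = k then -1 else 1) * K k $$ (i,j) * (if j = k then -1 else 1)"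
        unfolding S_def by (intro mat_diag_conjugate_entry Kc)
      then show "K (Suc k) $$ (i,j) = ((1/2) \<cdot>\<^sub>m (K k + S * K k * S)) $$ (i,j)"
        using ij Kc by (auto simp: K_def S_def mat_diag_def)
    qed (use Kc in \<open>auto simp: K_def S_def mat_diag_def\<close>)
    also have "N \<dots> \<le> N H"
      using Suc Kc S symmetric_norm_unitary[OF N Kc S S]
      by (intro symmetric_norm_midpoint[OF N]) (auto simp: unitary_carrier)
    finally show ?case .
  qed
  then have "N (K m) \<le> N H" by simp
  moreover have "K m = mat_diag m (\<lambda>i. H $$ (i,i))"
    by (rule eq_matI) (auto simp: K_def mat_diag_def)
  ultimately show ?thesis by simp
qed

text \<open>By the singular value decomposition, both products are unitarily similar to the diagonal matrix of
  the squared singular values.\<close>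

lemma symmetric_norm_gram_commute:
  assumes N: "symmetric_norm m N" and Z: "Z \<in> carrier_mat m m"
  shows "N (Z * mat_adjoint Z) = N (mat_adjoint Z * Z)"
proof -
  obtain U V s where U: "unitary_mat m U" and V: "unitary_mat m V"
    and ZU: "Z = U * mat_diag m (\<lambda>i. complex_of_real (s i)) * V"
    using singular_value_decomposition[OF Z] by blast
  let ?S = "mat_diag m (\<lambda>i. complex_of_real (s i))"
  have c: "U \<in> carrier_mat m m" "V \<in> carrier_mat m m" using U V by (auto simp: unitary_carrier)
  have "Z * mat_adjoint Z = U * (?S * ?S) * mat_adjoint U"
    unfolding ZU using c V
    by (simp add: adjoint_mult_square[of _ m] mult_assoc_square[of _ m] unitary_cancel[of m] del: mat_diag_diag)
  moreover have "mat_adjoint Z * Z = mat_adjoint V * (?S * ?S) * V"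
    unfolding ZU using c U
    by (simp add: adjoint_mult_square[of _ m] mult_assoc_square[of _ m] unitary_cancel[of m] del: mat_diag_diag)
  ultimately show ?thesis
    using U V by (simp add: symmetric_norm_unitary[OF N] unitary_adjoint del: mat_diag_diag)
qed

lemma Re_gram_cross_le:
  assumes F: "F \<in> carrier_mat m m" and G: "G \<in> carrier_mat m m" and i: "i < m"
  shows "2 * Re ((mat_adjoint F * G) $$ (i,i))
    \<le> (\<Sum>k<m. (cmod (F $$ (k,i)))\<^sup>2) + (\<Sum>k<m. (cmod (G $$ (k,i)))\<^sup>2)"
proof -
  have *: "2 * Re (cnj a * b) \<le> (cmod a)\<^sup>2 + (cmod b)\<^sup>2" for a b
    unfolding cmod_power2 using zero_le_power2[of "Re a - Re b"] zero_le_power2[of "Im a - Im b"]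
    by (simp add: power2_eq_square algebra_simps)
  have "2 * Re ((mat_adjoint F * G) $$ (i,i)) = (\<Sum>k<m. 2 * Re (cnj (F $$ (k,i)) * G $$ (k,i)))"
    using assms by (subst mult_entry[of _ m m _ m]) (auto simp: sum_distrib_left)
  also have "\<dots> \<le> (\<Sum>k<m. (cmod (F $$ (k,i)))\<^sup>2 + (cmod (G $$ (k,i)))\<^sup>2)"
    by (intro sum_mono *)
  finally show ?thesis by (simp add: sum.distrib)
qed

text \<open>Write \<open>T = U \<Sigma> V\<close> for the matrix on the left. Each singular value is a diagonal entry of \<open>U\<^sup>* T V\<^sup>*\<close>,
  hence a sum of inner products of columns of \<open>X\<^sub>k U\<close> and \<open>Y\<^sub>k V\<^sup>*\<close>. By the arithmetic-geometric mean
  inequality, \<open>2\<Sigma>\<close> is entrywise at most the diagonal of the sum \<open>H\<close> of conjugates of the two Gram matrices.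
  Monotonicity on diagonal matrices, pinching and the triangle inequality then bound its norm.\<close>

theorem symmetric_norm_arith_mean:
  assumes N: "symmetric_norm m N"
    and X: "X1 \<in> carrier_mat m m" "X2 \<in> carrier_mat m m"
    and Y: "Y1 \<in> carrier_mat m m" "Y2 \<in> carrier_mat m m"
  shows "2 * N (mat_adjoint X1 * Y1 + mat_adjoint X2 * Y2)
    \<le> N (mat_adjoint X1 * X1 + mat_adjoint X2 * X2) + N (mat_adjoint Y1 * Y1 + mat_adjoint Y2 * Y2)"
proof -
  let ?T = "mat_adjoint X1 * Y1 + mat_adjoint X2 * Y2"
  let ?P = "mat_adjoint X1 * X1 + mat_adjoint X2 * X2"
  let ?Q = "mat_adjoint Y1 * Y1 + mat_adjoint Y2 * Y2"
  have T: "?T \<in> carrier_mat m m" and P: "?P \<in> carrier_mat m m" and Q: "?Q \<in> carrier_mat m m"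
    using X Y by auto
  obtain U V s where U: "unitary_mat m U" and V: "unitary_mat m V" and s: "\<forall>i. 0 \<le> s i"
    and TU: "?T = U * mat_diag m (\<lambda>i. complex_of_real (s i)) * V"
    using singular_value_decomposition[OF T] by blast
  let ?S = "mat_diag m (\<lambda>i. complex_of_real (s i))"
  have c: "U \<in> carrier_mat m m" "V \<in> carrier_mat m m" using U V by (auto simp: unitary_carrier)
  define F1 F2 G1 G2 where "F1 = X1 * U" and "F2 = X2 * U"
    and "G1 = Y1 * mat_adjoint V" and "G2 = Y2 * mat_adjoint V"
  have FG: "F1 \<in> carrier_mat m m" "F2 \<in> carrier_mat m m" "G1 \<in> carrier_mat m m" "G2 \<in> carrier_mat m m"
    using X Y c by (auto simp: F1_def F2_def G1_def G2_def)
  note alg = adjoint_mult_square[of _ m] mult_assoc_square[of _ m]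
    add_mult_distrib_mat[of _ m m _ _ m] mult_add_distrib_mat[of _ m m _ m]
  have "?S = mat_adjoint U * ?T * mat_adjoint V"
    unfolding TU using c U V
    by (simp add: mult_assoc_square[of _ m] unitary_cancel[of m])
       (simp add: unitary_mat_def right_mult_one_mat[of _ m m])
  also have "\<dots> = mat_adjoint F1 * G1 + mat_adjoint F2 * G2"
    using X Y c by (simp add: F1_def F2_def G1_def G2_def alg)
  finally have S: "?S = mat_adjoint F1 * G1 + mat_adjoint F2 * G2" .
  define H where "H = (mat_adjoint F1 * F1 + mat_adjoint F2 * F2) + (mat_adjoint G1 * G1 + mat_adjoint G2 * G2)"
  have H: "H \<in> carrier_mat m m" using FG by (simp add: H_def)
  have PF: "mat_adjoint F1 * F1 + mat_adjoint F2 * F2 = mat_adjoint U * ?P * U"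
    using X c by (simp add: F1_def F2_def alg)
  have QG: "mat_adjoint G1 * G1 + mat_adjoint G2 * G2 = V * ?Q * mat_adjoint V"
    using Y c by (simp add: G1_def G2_def alg)
  have "N H \<le> N (mat_adjoint U * ?P * U) + N (V * ?Q * mat_adjoint V)"
    unfolding H_def PF QG using P Q c by (intro symmetric_norm_triangle[OF N]) auto
  also have "\<dots> = N ?P + N ?Q"
    using U V P Q by (simp add: symmetric_norm_unitary[OF N] unitary_adjoint)
  finally have NH: "N H \<le> N ?P + N ?Q" .
  define h where "h = (\<lambda>i. (\<Sum>k<m. (cmod (F1 $$ (k,i)))\<^sup>2) + (\<Sum>k<m. (cmod (F2 $$ (k,i)))\<^sup>2)
    + ((\<Sum>k<m. (cmod (G1 $$ (k,i)))\<^sup>2) + (\<Sum>k<m. (cmod (G2 $$ (k,i)))\<^sup>2)))"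
  have Hh: "H $$ (i,i) = complex_of_real (h i)" if "i < m" for i
    using that FG by (simp add: H_def h_def gram_diagonal[of _ m] del: index_mult_mat(1))
  have sh: "2 * s i \<le> h i" if i: "i < m" for i
  proof -
    have "2 * s i = 2 * Re (?S $$ (i,i))" using i by (simp add: mat_diag_def)
    also have "\<dots> = 2 * Re ((mat_adjoint F1 * G1) $$ (i,i)) + 2 * Re ((mat_adjoint F2 * G2) $$ (i,i))"
      unfolding S using FG i by simp
    also have "\<dots> \<le> h i"
      using Re_gram_cross_le[OF FG(1,3) i] Re_gram_cross_le[OF FG(2,4) i] by (simp add: h_def)
    finally show ?thesis .
  qed
  have "2 * N ?T = 2 * N ?S" unfolding TU using U V by (simp add: symmetric_norm_unitary[OF N])
  also have "\<dots> = N (2 \<cdot>\<^sub>m ?S)" by (subst symmetric_norm_scale[OF N]) auto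
  also have "2 \<cdot>\<^sub>m ?S = mat_diag m (\<lambda>i. complex_of_real (2 * s i))"
    by (rule eq_matI) (auto simp: mat_diag_def)
  also have "N \<dots> \<le> N (mat_diag m (\<lambda>i. complex_of_real (h i)))"
    using s sh by (intro symmetric_norm_diag_mono[OF N]) auto
  also have "mat_diag m (\<lambda>i. complex_of_real (h i)) = mat_diag m (\<lambda>i. H $$ (i,i))"
    by (rule eq_matI) (auto simp: mat_diag_def Hh)
  also have "N \<dots> \<le> N H" by (rule symmetric_norm_pinching[OF N H])
  finally show ?thesis using NH by simp
qed

text \<open>With Hermitian roots \<open>p\<close> of \<open>P\<close> and \<open>q\<close> of \<open>Q\<close>, let \<open>Z\<close> have first block column \<open>(p, q)\<close> and second
  block column zero. Then \<open>Z\<^sup>* Z = (P + Q) \<oplus> 0\<close>, while \<open>Z Z\<^sup>*\<close> has diagonal blocks \<open>P\<close> and \<open>Q\<close>. The two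
  have equal norms, and averaging \<open>Z Z\<^sup>*\<close> with its conjugate by \<open>J = I \<oplus> (-I)\<close> removes the off-diagonal
  blocks.\<close>

lemma symmetric_norm_block_diag_le:
  assumes N: "symmetric_norm (n + n) N" and P: "psd_mat n P" and Q: "psd_mat n Q"
  shows "N (four_block_mat P (0\<^sub>m n n) (0\<^sub>m n n) Q)
    \<le> N (four_block_mat (P + Q) (0\<^sub>m n n) (0\<^sub>m n n) (0\<^sub>m n n))"
proof -
  obtain p where p: "p \<in> carrier_mat n n" "mat_adjoint p = p" "p * p = P"
    using psd_hermitian_root[OF P] by blast
  obtain q where q: "q \<in> carrier_mat n n" "mat_adjoint q = q" "q * q = Q"
    using psd_hermitian_root[OF Q] by blast
  let ?O = "0\<^sub>m n n :: complex mat"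
  define Z where "Z = four_block_mat p ?O q ?O"
  define J where "J = mat_diag (n + n) (\<lambda>i. if i < n then 1 else (-1::complex))"
  have Z: "Z \<in> carrier_mat (n+n) (n+n)" using p q by (simp add: Z_def)
  have J: "unitary_mat (n+n) J" unfolding J_def by (rule unitary_mat_diag) auto
  have aZ: "mat_adjoint Z = four_block_mat p q ?O ?O"
    unfolding Z_def using p q by (simp add: adjoint_four_block_mat[of _ n n _ n _ n])
  have ZZ: "mat_adjoint Z * Z = four_block_mat (P + Q) ?O ?O ?O"
    unfolding aZ unfolding Z_def using p q by (simp add: mult_four_block_mat[of _ n n _ n _ n _ _ n _ n])
  have ZZ': "Z * mat_adjoint Z = four_block_mat P (p * q) (q * p) Q"
    unfolding aZ unfolding Z_def using p q P Q
    by (simp add: mult_four_block_mat[of _ n n _ n _ n _ _ n _ n] psd_mat_def)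
  let ?R = "Z * mat_adjoint Z"
  have R: "?R \<in> carrier_mat (n+n) (n+n)" using Z by simp
  have "four_block_mat P ?O ?O Q = (1/2) \<cdot>\<^sub>m (?R + J * ?R * J)"
  proof (rule eq_matI)
    fix i j assume "i < dim_row ((1/2) \<cdot>\<^sub>m (?R + J * ?R * J))" "j < dim_col ((1/2) \<cdot>\<^sub>m (?R + J * ?R * J))"
    then have ij: "i < n + n" "j < n + n" by (auto simp: J_def mat_diag_def)
    have "(J * ?R * J) $$ (i,j) = (if i < n then 1 else -1) * ?R $$ (i,j) * (if j < n then 1 else -1)"
      unfolding J_def by (rule mat_diag_conjugate_entry[OF R ij])
    then show "four_block_mat P ?O ?O Q $$ (i,j) = ((1/2) \<cdot>\<^sub>m (?R + J * ?R * J)) $$ (i,j)"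
      using ij p q by (auto simp: ZZ' J_def mat_diag_def)
  qed (use p q in \<open>auto simp: J_def mat_diag_def\<close>)
  also have "N \<dots> \<le> N ?R"
    using R J symmetric_norm_unitary[OF N R J J]
    by (intro symmetric_norm_midpoint[OF N]) (auto simp: unitary_carrier)
  also have "\<dots> = N (mat_adjoint Z * Z)" by (rule symmetric_norm_gram_commute[OF N Z])
  finally show ?thesis unfolding ZZ .
qed

section \<open>The block matrix inequality\<close>

lemma psd_mat_abs_normal:
  assumes "A \<in> carrier_mat n n" "normal_mat A"
  shows "psd_mat n (mat_abs A)"
  using normal_factorization[OF assms] psd_gram by metis

theorem theorem3p1:
  fixes n :: nat and A B C D :: "complex mat" and N :: "complex mat \<Rightarrow> real"
  assumes "n \<ge> 1"
    and "A \<in> carrier_mat n n" "B \<in> carrier_mat n n"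
      "C \<in> carrier_mat n n" "D \<in> carrier_mat n n"
    and "normal_mat A" "normal_mat B" "normal_mat C" "normal_mat D"
    and "symmetric_norm (2 * n) N"
  shows "N (four_block_mat A B C D)
    \<le> corner_norm n N (mat_abs A + mat_abs B + mat_abs C + mat_abs D)"
proof -
  have N: "symmetric_norm (n + n) N" using assms by (simp add: mult_2)
  let ?O = "0\<^sub>m n n :: complex mat"
  let ?a = "mat_abs A" and ?b = "mat_abs B" and ?c = "mat_abs C" and ?d = "mat_abs D"
  obtain xa ya where a: "xa \<in> carrier_mat n n" "ya \<in> carrier_mat n n" "A = mat_adjoint xa * ya"
    "mat_adjoint xa * xa = ?a" "mat_adjoint ya * ya = ?a"
    using normal_factorization[of A n] assms by metis
  obtain xb yb where b: "xb \<in> carrier_mat n n" "yb \<in> carrier_mat n n" "B = mat_adjoint xb * yb"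
    "mat_adjoint xb * xb = ?b" "mat_adjoint yb * yb = ?b"
    using normal_factorization[of B n] assms by metis
  obtain xc yc where c: "xc \<in> carrier_mat n n" "yc \<in> carrier_mat n n" "C = mat_adjoint xc * yc"
    "mat_adjoint xc * xc = ?c" "mat_adjoint yc * yc = ?c"
    using normal_factorization[of C n] assms by metis
  obtain xd yd where d: "xd \<in> carrier_mat n n" "yd \<in> carrier_mat n n" "D = mat_adjoint xd * yd"
    "mat_adjoint xd * xd = ?d" "mat_adjoint yd * yd = ?d"
    using normal_factorization[of D n] assms by metis
  have psd: "psd_mat n ?a" "psd_mat n ?b" "psd_mat n ?c" "psd_mat n ?d"
    using assms by (auto intro: psd_mat_abs_normal)
  then have abs: "?a \<in> carrier_mat n n" "?b \<in> carrier_mat n n" "?c \<in> carrier_mat n n" "?d \<in> carrier_mat n n"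
    by (auto simp: psd_mat_def)
  \<comment> \<open>Both left factors are block diagonal; only \<open>Y2\<close> moves \<open>B\<close> and \<open>C\<close> off the diagonal, so its
    Gram matrix lists \<open>\<bar>C\<bar>\<close> before \<open>\<bar>B\<bar>\<close>, opposite to that of \<open>X2\<close>.\<close>
  define X1 X2 Y1 Y2 where "X1 = four_block_mat xa ?O ?O xd" and "X2 = four_block_mat xb ?O ?O xc"
    and "Y1 = four_block_mat ya ?O ?O yd" and "Y2 = four_block_mat ?O yb yc ?O"
  have carr: "X1 \<in> carrier_mat (n+n) (n+n)" "X2 \<in> carrier_mat (n+n) (n+n)"
    "Y1 \<in> carrier_mat (n+n) (n+n)" "Y2 \<in> carrier_mat (n+n) (n+n)"
    using a b c d by (auto simp: X1_def X2_def Y1_def Y2_def)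
  note blk = adjoint_four_block_mat[of _ n n _ n _ n] mult_four_block_mat[of _ n n _ n _ n _ _ n _ n]
    add_four_block_mat[of _ n n _ n _ n]
  note cs = a(1,2) b(1,2) c(1,2) d(1,2)
  have T: "mat_adjoint X1 * Y1 + mat_adjoint X2 * Y2 = four_block_mat A B C D"
    using cs by (simp add: X1_def X2_def Y1_def Y2_def blk a(3) b(3) c(3) d(3))
  have P: "mat_adjoint X1 * X1 + mat_adjoint X2 * X2 = four_block_mat (?a + ?b) ?O ?O (?d + ?c)"
    using cs abs by (simp add: X1_def X2_def blk a(4) b(4) c(4) d(4))
  have Q: "mat_adjoint Y1 * Y1 + mat_adjoint Y2 * Y2 = four_block_mat (?a + ?c) ?O ?O (?d + ?b)"
    using cs abs by (simp add: Y1_def Y2_def blk a(5) b(5) c(5) d(5))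
  let ?S = "?a + ?b + ?c + ?d"
  have S1: "(?a + ?b) + (?d + ?c) = ?S" "(?a + ?c) + (?d + ?b) = ?S"
    by (rule eq_matI; use abs in auto)+
  have "2 * N (four_block_mat A B C D)
      \<le> N (four_block_mat (?a + ?b) ?O ?O (?d + ?c)) + N (four_block_mat (?a + ?c) ?O ?O (?d + ?b))"
    using symmetric_norm_arith_mean[OF N carr] unfolding T P Q .
  also have "\<dots> \<le> N (four_block_mat ?S ?O ?O ?O) + N (four_block_mat ?S ?O ?O ?O)"
    using symmetric_norm_block_diag_le[OF N psd_add[OF psd(1,2)] psd_add[OF psd(4,3)]]
      symmetric_norm_block_diag_le[OF N psd_add[OF psd(1,3)] psd_add[OF psd(4,2)]]
    unfolding S1 by (rule add_mono)
  finally show ?thesis by (simp add: corner_norm_def)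
qed

end
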